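(* Let $\alpha$ be an infinite ordinal. Every simple polyadic equality algebra of dimension $\alpha$ (that is, every simple $\mathfrak{A}\in\mathbf{PEA}_{\alpha}$) which is generated by finitely many elements is generated by a single element.
   Context: Let $\alpha$ be an ordinal. A polyadic algebra of dimension $\alpha$ is an algebra $\mathfrak{A}=\langle A,+,\cdot,-,0,1,\mathsf{c}_{(\Gamma)},\mathsf{s}_{\tau}\rangle_{\Gamma\subseteq\alpha,\ \tau\in{}^{\alpha}\alpha}$, where ${}^{\alpha}\alpha$ is the set of all maps $\alpha\to\alpha$ and all $\mathsf{c}_{(\Gamma)},\mathsf{s}_{\tau}$ are unary operations, such that $\langle A,+,\cdot,-,0,1\rangle$ is a Boolean algebra and for all $x,y\in A$, $\Gamma,\Delta\subseteq\alpha$, $\sigma,\tau\in{}^{\alpha}\alpha$: - $\mathsf{c}_{(\Gamma)}0=0$; $x\le\mathsf{c}_{(\Gamma)}x$; $\mathsf{c}_{(\Gamma)}(x\cdot\mathsf{c}_{(\Gamma)}y)=\mathsf{c}_{(\Gamma)}x\cdot\mathsf{c}_{(\Gamma)}y$; $\mathsf{c}_{(\emptyset)}x=x$; $\mathsf{c}_{(\Gamma)}\mathsf{c}_{(\Delta)}x=\mathsf{c}_{(\Gamma\cup\Delta)}x$; - $\mathsf{s}_{Id}x=x$; $\mathsf{s}_{\sigma\circ\tau}x=\mathsf{s}_{\sigma}\mathsf{s}_{\tau}x$; $\mathsf{s}_{\sigma}(x+y)=\mathsf{s}_{\sigma}x+\mathsf{s}_{\sigma}y$; $\mathsf{s}_{\sigma}(-x)=-\mathsf{s}_{\sigma}x$;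 - if $\sigma\upharpoonright(\alpha\setminus\Gamma)=\tau\upharpoonright(\alpha\setminus\Gamma)$, then $\mathsf{s}_{\sigma}\mathsf{c}_{(\Gamma)}x=\mathsf{s}_{\tau}\mathsf{c}_{(\Gamma)}x$; - if $\Delta=\sigma^{-1}(\Gamma)$ and $\sigma\upharpoonright\Delta$ is one-to-one, then $\mathsf{c}_{(\Gamma)}\mathsf{s}_{\sigma}x=\mathsf{s}_{\sigma}\mathsf{c}_{(\Delta)}x$. A polyadic equality algebra of dimension $\alpha$ is a polyadic algebra of dimension $\alpha$ with additional constants $\mathsf{d}_{ij}$ ($i,j<\alpha$) such that for all $i,j<\alpha$, $x\in A$, $\tau\in{}^{\alpha}\alpha$: $\mathsf{d}_{ii}=1$; $x\cdot\mathsf{d}_{ij}\le\mathsf{s}_{[i/j]}x$, where $[i/j]$ maps $i$ to $j$ and fixes all other elements of $\alpha$; and $\mathsf{s}_{\tau}\mathsf{d}_{ij}=\mathsf{d}_{\tau(i)\tau(j)}$. The class of these algebras is denoted $\mathbf{PEA}_{\alpha}$. "Generated" means generated under all the operations of $\mathbf{PEA}_{\alpha}$ (including all $\mathsf{c}_{(\Gamma)}$, $\mathsf{s}_{\tau}$ and the constants $\mathsf{d}_{ij}$). An algebra is simple if it has more than one element and its only congruences are the identity and the universal one. *)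

theory Defs
  imports Main
begin

text \<open>
  The dimension is an infinite ordinal. It is rendered by the index type \<open>'i\<close>: its elements are
  the ordinals below the dimension, so subsets of the dimension are the sets of type \<open>'i set\<close> and
  its self-maps are the functions \<open>'i \<Rightarrow> 'i\<close>. The order of \<open>'i\<close> occurs in none of the axioms
  and is therefore only required (as the class \<open>wellorder\<close>) in the main statement. The universe of
  an algebra is the type \<open>'a\<close>, with Boolean reduct given by the class \<open>boolean_algebra\<close>
  (which admits the one-element algebra).
\<close>

locale polyadic_algebra =
  fixes c :: "'i set \<Rightarrow> 'a::boolean_algebra \<Rightarrow> 'a"
    and s :: "('i \<Rightarrow> 'i) \<Rightarrow> 'a \<Rightarrow> 'a"
  assumes c_bot: "c \<Gamma> bot = bot"
    and c_increasing: "x \<le> c \<Gamma> x"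
    and c_inf_c: "c \<Gamma> (inf x (c \<Gamma> y)) = inf (c \<Gamma> x) (c \<Gamma> y)"
    and c_empty: "c {} x = x"
    and c_c: "c \<Gamma> (c \<Delta> x) = c (\<Gamma> \<union> \<Delta>) x"
    and s_id: "s id x = x"
    and s_comp: "s (\<sigma> \<circ> \<tau>) x = s \<sigma> (s \<tau> x)"
    and s_sup: "s \<sigma> (sup x y) = sup (s \<sigma> x) (s \<sigma> y)"
    and s_compl: "s \<sigma> (- x) = - s \<sigma> x"
    and s_c_cong: "(\<forall>i\<in>- \<Gamma>. \<sigma> i = \<tau> i) \<Longrightarrow> s \<sigma> (c \<Gamma> x) = s \<tau> (c \<Gamma> x)"
    and c_s: "\<Delta> = \<sigma> -` \<Gamma> \<Longrightarrow> inj_on \<sigma> \<Delta> \<Longrightarrow> c \<Gamma> (s \<sigma> x) = s \<sigma> (c \<Delta> x)"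

locale polyadic_equality_algebra = polyadic_algebra c s
  for c :: "'i set \<Rightarrow> 'a::boolean_algebra \<Rightarrow> 'a"
    and s :: "('i \<Rightarrow> 'i) \<Rightarrow> 'a \<Rightarrow> 'a" +
  fixes d :: "'i \<Rightarrow> 'i \<Rightarrow> 'a"
  assumes d_refl: "d i i = top"
    and inf_d_le: "inf x (d i j) \<le> s (id(i := j)) x"
    and s_d: "s \<tau> (d i j) = d (\<tau> i) (\<tau> j)"

inductive_set generated ::
    "('i set \<Rightarrow> 'a::boolean_algebra \<Rightarrow> 'a) \<Rightarrow> (('i \<Rightarrow> 'i) \<Rightarrow> 'a \<Rightarrow> 'a) \<Rightarrow>
     ('i \<Rightarrow> 'i \<Rightarrow> 'a) \<Rightarrow> 'a set \<Rightarrow> 'a set"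
  for c s d X where
  gen_base: "x \<in> X \<Longrightarrow> x \<in> generated c s d X"
| gen_bot: "bot \<in> generated c s d X"
| gen_top: "top \<in> generated c s d X"
| gen_sup: "x \<in> generated c s d X \<Longrightarrow> y \<in> generated c s d X \<Longrightarrow> sup x y \<in> generated c s d X"
| gen_inf: "x \<in> generated c s d X \<Longrightarrow> y \<in> generated c s d X \<Longrightarrow> inf x y \<in> generated c s d X"
| gen_compl: "x \<in> generated c s d X \<Longrightarrow> - x \<in> generated c s d X"
| gen_c: "x \<in> generated c s d X \<Longrightarrow> c \<Gamma> x \<in> generated c s d X"
| gen_s: "x \<in> generated c s d X \<Longrightarrow> s \<tau> x \<in> generated c s d X"
| gen_d: "d i j \<in> generated c s d X"

text \<open>Constants such as the diagonal elements impose no condition on a congruence.\<close>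

definition congruence ::
    "('i set \<Rightarrow> 'a::boolean_algebra \<Rightarrow> 'a) \<Rightarrow> (('i \<Rightarrow> 'i) \<Rightarrow> 'a \<Rightarrow> 'a) \<Rightarrow> 'a rel \<Rightarrow> bool" where
  "congruence c s R \<longleftrightarrow>
     equiv UNIV R \<and>
     (\<forall>x x' y y'. (x, x') \<in> R \<longrightarrow> (y, y') \<in> R \<longrightarrow> (sup x y, sup x' y') \<in> R) \<and>
     (\<forall>x x' y y'. (x, x') \<in> R \<longrightarrow> (y, y') \<in> R \<longrightarrow> (inf x y, inf x' y') \<in> R) \<and>
     (\<forall>x x'. (x, x') \<in> R \<longrightarrow> (- x, - x') \<in> R) \<and>
     (\<forall>\<Gamma> x x'. (x, x') \<in> R \<longrightarrow> (c \<Gamma> x, c \<Gamma> x') \<in> R) \<and>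
     (\<forall>\<tau> x x'. (x, x') \<in> R \<longrightarrow> (s \<tau> x, s \<tau> x') \<in> R)"

definition simple_algebra ::
    "('i set \<Rightarrow> 'a::boolean_algebra \<Rightarrow> 'a) \<Rightarrow> (('i \<Rightarrow> 'i) \<Rightarrow> 'a \<Rightarrow> 'a) \<Rightarrow> bool" where
  "simple_algebra c s \<longleftrightarrow>
     (\<exists>x y :: 'a. x \<noteq> y) \<and> (\<forall>R. congruence c s R \<longrightarrow> R = Id \<or> R = UNIV)"

end

(*
  For injective \<sigma>, \<tau> with disjoint ranges, s_\<sigma> x does not depend on the coordinates in the range of \<tau>,
  whereas cylindrifying s_\<tau> y over them yields c_(\<alpha>) y, which is 1 in a simple algebra if y is not 0.
  So x and y are both recovered from the single element s_\<sigma> x \<cdot> s_\<tau> y, by cylindrifying and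
  substituting along a left inverse. Such maps exist because \<alpha> + \<alpha> injects into \<alpha>.
*)
theory Submission
  imports Defs
begin

lemma infinite_disjoint_injections:
  assumes "infinite (UNIV :: 'i set)"
  obtains \<sigma> \<tau> :: "'i \<Rightarrow> 'i" where "inj \<sigma>" "inj \<tau>" "range \<sigma> \<inter> range \<tau> = {}"
proof -
  have "(card_of ((UNIV :: 'i set) <+> (UNIV :: 'i set)), card_of (UNIV :: 'i set)) \<in> ordLeq"
    using card_of_Plus_infinite[OF assms, of "UNIV :: 'i set"] card_of_mono1[of UNIV UNIV]
      ordIso_iff_ordLeq by blast
  then obtain f :: "'i + 'i \<Rightarrow> 'i" where f: "inj f"
    by (auto simp: card_of_ordLeq[symmetric])
  show thesis
  proof
    show "inj (f \<circ> Inl)" "inj (f \<circ> Inr)" "range (f \<circ> Inl) \<inter> range (f \<circ> Inr) = {}"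
      using f by (auto simp: inj_def)
  qed
qed

lemma generated_subset:
  assumes "X \<subseteq> generated c s d Y"
  shows "generated c s d X \<subseteq> generated c s d Y"
proof
  fix x assume "x \<in> generated c s d X"
  then show "x \<in> generated c s d Y"
    by induction (use assms in \<open>auto intro: generated.intros\<close>)
qed

context polyadic_algebra
begin

lemma s_inf: "s \<sigma> (inf x y) = inf (s \<sigma> x) (s \<sigma> y)"
  using s_compl[of \<sigma> "sup (- x) (- y)"] by (simp add: s_sup s_compl)

text \<open>Any two maps agree on the empty complement of \<open>UNIV\<close>, so \<tau> may be
  replaced by \<open>id\<close>.\<close>

lemma s_c_UNIV: "s \<tau> (c UNIV x) = c UNIV x"
  using s_c_cong[of UNIV \<tau> id x] by (simp add: s_id)

text \<open>All cylindrifications and substitutions fix \<open>c UNIV y\<close>, so meeting with it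
  commutes with them: the relation is the kernel of relativization to this element.\<close>

lemma congruence_inf_c_UNIV: "congruence c s {(a, b). inf a (c UNIV y) = inf b (c UNIV y)}"
proof -
  define e where "e = c UNIV y"
  have c_e: "inf (c \<Gamma> a) e = c \<Gamma> (inf a e)" for \<Gamma> a
    using c_inf_c[of \<Gamma> a e] by (simp add: e_def c_c)
  have s_e: "inf (s \<tau> a) e = s \<tau> (inf a e)" for \<tau> a
    by (simp add: e_def s_inf s_c_UNIV)
  \<comment> \<open>Meeting with \<open>e\<close> does not commute with complement, but the meet of
    \<open>- a\<close> with \<open>e\<close> is determined by \<open>inf a e\<close>, which is
    enough for compatibility.\<close>
  have compl_e: "inf (- a) e = inf (- inf a e) e" for a
    by (simp add: inf_sup_distrib2)
  have inf_e: "inf (inf a b) e = inf (inf a e) (inf b e)" for a b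
    by (simp add: inf.assoc inf.left_commute)
  have "congruence c s {(a, b). inf a e = inf b e}"
    unfolding congruence_def equiv_def refl_on_def sym_def trans_def
    by (auto simp: inf_sup_distrib2 inf_e c_e s_e) (metis compl_e)+
  then show ?thesis
    by (simp add: e_def)
qed

text \<open>The relativization congruence identifies \<open>top\<close> with
  \<open>c UNIV y\<close>. It is not universal, since relating \<open>top\<close> to
  \<open>bot\<close> would make \<open>c UNIV y\<close> equal to \<open>bot\<close>; hence it is the
  identity.\<close>

lemma simple_c_UNIV:
  assumes "simple_algebra c s" "y \<noteq> bot"
  shows "c UNIV y = top"
proof -
  let ?R = "{(a, b). inf a (c UNIV y) = inf b (c UNIV y)}"
  have "(top, c UNIV y) \<in> ?R"
    by simp
  moreover have "c UNIV y \<noteq> bot"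
    using c_increasing[of y UNIV] assms(2) by (metis bot.extremum_uniqueI)
  then have "(top, bot) \<notin> ?R"
    by simp
  ultimately show ?thesis
    using assms(1) congruence_inf_c_UNIV[of y] unfolding simple_algebra_def by blast
qed

lemma simple_factor_generated:
  assumes "simple_algebra c s" "y \<noteq> bot" "inj \<sigma>" "inj \<tau>" "range \<sigma> \<inter> range \<tau> = {}"
  shows "x \<in> generated c s d {inf (s \<sigma> x) (s \<tau> y)}"
proof -
  let ?z = "inf (s \<sigma> x) (s \<tau> y)"
  \<comment> \<open>By disjointness the preimage of \<open>range \<tau>\<close> under \<sigma> is
    empty, so \<open>c_s\<close> turns the cylindrification into \<open>c {}\<close>.\<close>
  have x: "c (range \<tau>) (s \<sigma> x) = s \<sigma> x"
    using c_s[of "{}" \<sigma> "range \<tau>" x] assms(5) by (auto simp: c_empty)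
  \<comment> \<open>The preimage under \<tau> is all of \<open>UNIV\<close>, where \<tau> is
    injective.\<close>
  have "c (range \<tau>) (s \<tau> y) = s \<tau> (c UNIV y)"
    using c_s[of UNIV \<tau> "range \<tau>" y] assms(4) by auto
  then have "c (range \<tau>) (s \<tau> y) = top"
    using simple_c_UNIV[OF assms(1,2)] s_c_UNIV[of \<tau> y] by simp
  then have "c (range \<tau>) ?z = s \<sigma> x"
    using c_inf_c[of "range \<tau>" "s \<tau> y" "s \<sigma> x"] x by (simp add: inf.commute)
  moreover have "s (inv \<sigma>) (s \<sigma> x) = x"
    using assms(3) by (simp add: s_comp[symmetric] s_id)
  ultimately have "s (inv \<sigma>) (c (range \<tau>) ?z) = x"
    by simp
  then show ?thesis
    by (metis generated.gen_base generated.gen_c generated.gen_s insertI1)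
qed

lemma simple_pair_generated:
  fixes x y :: 'a
  assumes "infinite (UNIV :: 'i set)" "simple_algebra c s"
  obtains z where "{x, y} \<subseteq> generated c s d {z}"
proof (cases "x = bot \<or> y = bot")
  case True
  \<comment> \<open>One of the two is \<open>bot\<close>, so the join is the other one.\<close>
  then have "{x, y} \<subseteq> generated c s d {sup x y}"
    by (auto intro: generated.intros)
  then show thesis
    by (rule that)
next
  case False
  obtain \<sigma> \<tau> :: "'i \<Rightarrow> 'i" where *: "inj \<sigma>" "inj \<tau>" "range \<sigma> \<inter> range \<tau> = {}"
    using infinite_disjoint_injections[OF assms(1)] .
  have "x \<in> generated c s d {inf (s \<sigma> x) (s \<tau> y)}"
    using simple_factor_generated[OF assms(2)] False * by blast
  \<comment> \<open>The same argument with \<sigma> and \<tau> exchanged; it needs \<open>x\<close>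
    to be nonzero.\<close>
  moreover have "y \<in> generated c s d {inf (s \<tau> y) (s \<sigma> x)}"
    using simple_factor_generated[OF assms(2)] False * by (metis inf_commute)
  ultimately show thesis
    using that by (simp add: inf.commute)
qed

lemma simple_finite_generated:
  fixes X :: "'a set"
  assumes "infinite (UNIV :: 'i set)" "simple_algebra c s" "finite X"
  shows "\<exists>x. X \<subseteq> generated c s d {x}"
  using assms(3)
proof induction
  case empty
  then show ?case
    by simp
next
  case (insert y X)
  then obtain x where x: "X \<subseteq> generated c s d {x}"
    by blast
  \<comment> \<open>The generator \<open>x\<close> of the earlier elements and the new
    \<open>y\<close> are merged into one.\<close>
  obtain z where z: "{x, y} \<subseteq> generated c s d {z}"
    using simple_pair_generated[OF assms(1,2)] .
  then have "X \<subseteq> generated c s d {z}"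
    using x generated_subset[of "{x}" c s d "{z}"] by auto
  then show ?case
    using z by auto
qed

end

theorem mainTheorem2:
  fixes c :: "'i::wellorder set \<Rightarrow> 'a::boolean_algebra \<Rightarrow> 'a"
    and s :: "('i \<Rightarrow> 'i) \<Rightarrow> 'a \<Rightarrow> 'a"
    and d :: "'i \<Rightarrow> 'i \<Rightarrow> 'a"
  assumes "infinite (UNIV :: 'i set)"
    and "polyadic_equality_algebra c s d"
    and "simple_algebra c s"
    and "\<exists>X. finite X \<and> generated c s d X = UNIV"
  shows "\<exists>x. generated c s d {x} = UNIV"
proof -
  interpret polyadic_equality_algebra c s d
    by fact
  obtain X where X: "finite X" "generated c s d X = UNIV"
    using assms(4) by blast
  obtain x where "X \<subseteq> generated c s d {x}"
    using simple_finite_generated[OF assms(1,3) X(1)] by blast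
  then show ?thesis
    using generated_subset[of X c s d "{x}"] X(2) by auto
qed

end
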